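(* Let $w\ge 0$ be an integer. Let $q$ be a complex number with $|q|<1$ and let $t\neq 0$ be a complex number such that the power series $G'_w(t,q)$ converges absolutely. Let $\lambda$ be a root of $\lambda^2-\lambda(1-q)/t+1=0$ and put $\bar\lambda=1/\lambda$. Then, whenever all denominators occurring below (including those in the definitions of $\psi(\lambda,\cdot)$ and $\psi(\bar\lambda,\cdot)$) are nonzero, $$G'_w(t,q)=\cfrac{1}{1-\dfrac{\lambda^2(1-q)\left[\bar{\lambda}^w\psi(\lambda,q^{2})\psi(\bar{\lambda},q^{w+2})-\lambda^w\psi(\bar{\lambda},q^{2})\psi(\lambda,q^{w+2})\right]}{(1+\lambda^2)\left[\bar{\lambda}^w\psi(\lambda,q)\psi(\bar{\lambda},q^{w+2})-\lambda^{w+2}\psi(\bar{\lambda},q)\psi(\lambda,q^{w+2})\right]}}\,.$$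
   Context: A Dyck path of length $2N$ is a lattice path from $(0,0)$ to $(2N,0)$ with $N$ steps $(1,1)$ and $N$ steps $(1,-1)$ that never goes below $y=0$. Its steps are labelled: $a_j$ is a step $(1,1)$ starting at height $j\ge 0$, and $b_k$ is a step $(1,-1)$ starting at height $k\ge1$. Thus a Dyck path is encoded as a word $u_1u_2\cdots u_{2N}$ in these labels. Given a possibility function $pos:\{a_0,a_1,\ldots\}\cup\{b_1,b_2,\ldots\}\to\mathbb{N}_0$, a path diagram is a Dyck path $u_1\cdots u_{2N}$ together with a sequence of integers $s_1,\ldots,s_{2N}$ with $0\le s_i\le pos(u_i)$ for all $i$. Here the possibility function is $pos(a_j)=j$ for $j\ge0$, $pos(b_k)=k-1$ for $k\ge1$. Let $b^{(w)}_{N,m}$ be the number of such path diagrams whose Dyck path has length $2N$ and never exceeds height $w$ (a slit of width $w$), and with $s_1+\cdots+s_{2N}=m$ (the empty path counts once for $N=0$, $m=0$). Define $$G'_w(t,q)=\sum_{N,m\ge0}b^{(w)}_{N,m}t^{2N}q^m$$ (the prime is part of the name, not a derivative). Notation: $(a;q)_n=\prod_{k=0}^{n-1}(1-aq^k)$, $i=\sqrt{-1}$, $\sqrt q$ is a fixed square root of $q$, and $$\psi(\lambda,x)=\sum_{k=0}^\infty\frac{(i\lambda\sqrt q;q)_k(-i\lambda\sqrt q;q)_k\,x^k}{(\lambda^2q;q)_k(q;q)_k}.$$ *)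

theory Defs
  imports "HOL-Analysis.Analysis"
begin

text \<open>
  \<open>StepA j\<close> is the label $a_j$ of a step $(1,1)$ starting at height $j \ge 0$, and \<open>StepB k\<close> is the
  label $b_k$ of a step $(1,-1)$ starting at height $k \ge 1$. The junk label \<open>StepB 0\<close> never occurs
  in a Dyck path, since the step would lead below $y = 0$.
\<close>

datatype step = StepA nat | StepB nat

fun start_height :: "step \<Rightarrow> nat" where
  "start_height (StepA j) = j"
| "start_height (StepB k) = k"

fun rise :: "step \<Rightarrow> int" where
  "rise (StepA j) = 1"
| "rise (StepB k) = - 1"

definition height :: "step list \<Rightarrow> nat \<Rightarrow> int" where
  "height u i = (\<Sum>s\<leftarrow>take i u. rise s)"

definition dyck_path :: "nat \<Rightarrow> step list \<Rightarrow> bool" where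
  "dyck_path N u \<longleftrightarrow>
     length u = 2 * N \<and>
     (\<forall>i\<le>2 * N. 0 \<le> height u i) \<and>
     height u (2 * N) = 0 \<and>
     (\<forall>i<2 * N. int (start_height (u ! i)) = height u i)"

definition path_diagrams ::
  "(step \<Rightarrow> nat) \<Rightarrow> nat \<Rightarrow> nat \<Rightarrow> nat \<Rightarrow> (step list \<times> nat list) set" where
  "path_diagrams pos w N m =
     {(u, s). dyck_path N u \<and> (\<forall>i\<le>2 * N. height u i \<le> int w) \<and>
              length s = 2 * N \<and> (\<forall>i<2 * N. s ! i \<le> pos (u ! i)) \<and> sum_list s = m}"

text \<open>The sets counted below are finite, so that \<open>card\<close> is the actual number of path diagrams.\<close>

lemma finite_path_diagrams: "finite (path_diagrams pos w N m)"
proof -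
  let ?L = "StepA ` {..w} \<union> StepB ` {..w}"
  have "path_diagrams pos w N m \<subseteq>
          {u. set u \<subseteq> ?L \<and> length u = 2 * N} \<times> {s. set s \<subseteq> {..m} \<and> length s = 2 * N}"
  proof (clarsimp simp: path_diagrams_def, intro conjI)
    fix u :: "step list" and s :: "nat list"
    assume d: "dyck_path N u" and w: "\<forall>i\<le>2 * N. height u i \<le> int w"
    show "set u \<subseteq> ?L"
    proof
      fix x assume "x \<in> set u"
      then obtain i where i: "i < length u" "x = u ! i" by (auto simp: in_set_conv_nth)
      have "int (start_height x) \<le> int w"
        using d w i by (auto simp: dyck_path_def)
      then show "x \<in> ?L" by (cases x) auto
    qed
    show "length u = 2 * N" using d by (simp add: dyck_path_def)
    show "set s \<subseteq> {..sum_list s}" by (auto intro: member_le_sum_list)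
  qed
  moreover have "finite ({u. set u \<subseteq> ?L \<and> length u = 2 * N} \<times>
                         {s. set s \<subseteq> {..m} \<and> length s = 2 * N})"
    by (intro finite_cartesian_product finite_lists_length_eq) auto
  ultimately show ?thesis by (rule finite_subset)
qed

fun pos :: "step \<Rightarrow> nat" where
  "pos (StepA j) = j"
| "pos (StepB k) = k - 1"

definition num_diagrams :: "nat \<Rightarrow> nat \<Rightarrow> nat \<Rightarrow> nat" where
  "num_diagrams w N m = card (path_diagrams pos w N m)"

definition Gprime_term :: "nat \<Rightarrow> complex \<Rightarrow> complex \<Rightarrow> nat \<times> nat \<Rightarrow> complex" where
  "Gprime_term w t q = (\<lambda>(N, m). of_nat (num_diagrams w N m) * t ^ (2 * N) * q ^ m)"

definition Gprime :: "nat \<Rightarrow> complex \<Rightarrow> complex \<Rightarrow> complex" where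
  "Gprime w t q = (\<Sum>\<^sub>\<infinity>p. Gprime_term w t q p)"

definition qpoch :: "complex \<Rightarrow> complex \<Rightarrow> nat \<Rightarrow> complex" where
  "qpoch a q n = (\<Prod>k<n. 1 - a * q ^ k)"

text \<open>The parameter \<open>r\<close> is the chosen square root of \<open>q\<close>.\<close>

definition psi :: "complex \<Rightarrow> complex \<Rightarrow> complex \<Rightarrow> complex \<Rightarrow> complex" where
  "psi q r l x =
     (\<Sum>k. qpoch (\<i> * l * r) q k * qpoch (- \<i> * l * r) q k * x ^ k /
          (qpoch (l\<^sup>2 * q) q k * qpoch q q k))"

end

(*
Let g(k) be the generating function of the weighted lattice paths in the strip from height k down
to height 0. Splitting off the first step gives, with [k] = (1 - q^k) / (1 - q),
  g(k) = delta(k,0) + t [k+1] g(k+1) + t [k] g(k-1),   g(w+1) = 0;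
all these series converge absolutely because every path from height k extends to one from height 0.
Comparing coefficients in psi yields a q-difference equation, which says that l^k psi(l, q^(k+1))
solves the same recurrence for k >= 1 as soon as t (l + 1/l) = 1 - q, and so does the solution with
l replaced by 1/l. The combination y of the two that vanishes at w + 1 must be proportional to g,
and the equation at k = 0 gives g(0) = 1 / (1 - t y(1) / y(0)).
*)

theory Submission
  imports Defs
begin

section \<open>Weighted paths in a strip\<close>

lemma height_0 [simp]: "height u 0 = 0"
  by (simp add: height_def)

lemma height_Cons_Suc [simp]: "height (x # u) (Suc i) = rise x + height u i"
  by (simp add: height_def)

text \<open>The start height \<open>k\<close> is arbitrary because removing the first step of a Dyck
  path leaves a path of this more general kind. \<open>height\<close> is relative to the start,
  hence the shift by \<open>k\<close>; \<open>n\<close> is the full length, so both parities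
  occur.\<close>

definition strip_path :: "nat \<Rightarrow> nat \<Rightarrow> nat \<Rightarrow> step list \<Rightarrow> bool" where
  "strip_path w k n u \<longleftrightarrow>
     length u = n \<and>
     (\<forall>i\<le>n. 0 \<le> int k + height u i \<and> int k + height u i \<le> int w) \<and>
     int k + height u n = 0 \<and>
     (\<forall>i<n. int (start_height (u ! i)) = int k + height u i)"

lemma strip_path_0: "strip_path w k 0 u \<longleftrightarrow> u = [] \<and> k = 0"
  by (auto simp: strip_path_def)

lemma strip_path_beyond: "w < k \<Longrightarrow> \<not> strip_path w k n u"
  by (force simp: strip_path_def)

lemma All_le_Suc: "(\<forall>i\<le>Suc n. P i) \<longleftrightarrow> P 0 \<and> (\<forall>i\<le>n. P (Suc i))"
  by (metis Suc_le_mono not0_implies_Suc zero_le)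

lemma strip_path_StepA:
  assumes "k \<le> w"
  shows "strip_path w k (Suc n) (StepA j # u) \<longleftrightarrow> j = k \<and> strip_path w (Suc k) n u"
  using assms by (auto simp: strip_path_def All_le_Suc All_less_Suc2 add_ac)

text \<open>The conjunct \<open>0 < k\<close> guards the truncated \<open>k - 1\<close>: a down step
  from height 0 would reach -1.\<close>

lemma strip_path_StepB:
  assumes "k \<le> w"
  shows "strip_path w k (Suc n) (StepB j # u) \<longleftrightarrow> j = k \<and> 0 < k \<and> strip_path w (k - 1) n u"
proof (cases k)
  case 0
  then show ?thesis
    by (force simp: strip_path_def All_le_Suc)
next
  case (Suc k')
  then show ?thesis
    using assms by (auto simp: strip_path_def All_le_Suc All_less_Suc2 add_ac)
qed

text \<open>The label sum is left free, so that one finite set carries the whole polynomial in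
  \<open>q\<close>.\<close>

definition diagrams_from :: "nat \<Rightarrow> nat \<Rightarrow> nat \<Rightarrow> (step list \<times> nat list) set" where
  "diagrams_from w k n =
     {(u, s). strip_path w k n u \<and> length s = n \<and> (\<forall>i<n. s ! i \<le> pos (u ! i))}"

definition cons_diagram :: "step \<Rightarrow> nat \<times> step list \<times> nat list \<Rightarrow> step list \<times> nat list" where
  "cons_diagram x = (\<lambda>(a, u, s). (x # u, a # s))"

lemma inj_cons_diagram: "inj_on (cons_diagram x) A"
  by (auto simp: cons_diagram_def inj_on_def)

lemma diagrams_from_0: "diagrams_from w k 0 = (if k = 0 then {([], [])} else {})"
  by (auto simp: diagrams_from_def strip_path_0)

lemma diagrams_from_beyond: "w < k \<Longrightarrow> diagrams_from w k n = {}"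
  by (auto simp: diagrams_from_def strip_path_beyond)

text \<open>An up step at height \<open>k\<close> admits the labels 0 to \<open>k\<close>, a down
  step only 0 to \<open>k - 1\<close>. At \<open>k = 0\<close> the range \<open>{..<k}\<close> is
  empty, which removes the down step; at \<open>k = w\<close> the up part is empty because no path
  starts above the strip.\<close>

lemma diagrams_from_Suc:
  assumes "k \<le> w"
  shows "diagrams_from w k (Suc n) =
           cons_diagram (StepA k) ` ({..k} \<times> diagrams_from w (Suc k) n) \<union>
           cons_diagram (StepB k) ` ({..<k} \<times> diagrams_from w (k - 1) n)" (is "?L = ?R")
proof (intro set_eqI iffI)
  fix d assume d: "d \<in> ?L"
  obtain u s where us: "d = (u, s)" by (cases d)
  with d have len: "length u = Suc n" "length s = Suc n"
    by (auto simp: diagrams_from_def strip_path_def)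
  then obtain x u' a s' where c: "u = x # u'" "s = a # s'"
    by (metis length_Suc_conv)
  show "d \<in> ?R"
  proof (cases x)
    case (StepA j)
    with d us c have "(u', s') \<in> diagrams_from w (Suc k) n" "j = k" "a \<le> k"
      by (auto simp: diagrams_from_def strip_path_StepA[OF assms] All_less_Suc2)
    with us c StepA show ?thesis
      by (force simp: cons_diagram_def)
  next
    case (StepB j)
    with d us c have "(u', s') \<in> diagrams_from w (k - 1) n" "j = k" "a < k"
      by (auto simp: diagrams_from_def strip_path_StepB[OF assms] All_less_Suc2)
    with us c StepB show ?thesis
      by (force simp: cons_diagram_def)
  qed
next
  fix d assume "d \<in> ?R"
  then show "d \<in> ?L"
    by (auto simp: cons_diagram_def diagrams_from_def strip_path_StepA[OF assms]
        strip_path_StepB[OF assms] All_less_Suc2)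
qed

lemma finite_diagrams_from: "finite (diagrams_from w k n)"
proof (induction n arbitrary: k)
  case 0
  show ?case by (simp add: diagrams_from_0)
next
  case (Suc n)
  show ?case
    by (cases "k \<le> w") (auto simp: diagrams_from_Suc diagrams_from_beyond Suc)
qed

section \<open>Weights of the paths of fixed length, and bounds for them\<close>

text \<open>This is the coefficient of \<open>t ^ n\<close> in the generating function from height
  \<open>k\<close>. It is polymorphic because it is evaluated both at \<open>q\<close> and at the
  real number \<open>norm q\<close>.\<close>

definition path_weight :: "nat \<Rightarrow> 'a::comm_ring_1 \<Rightarrow> nat \<Rightarrow> nat \<Rightarrow> 'a" where
  "path_weight w q k n = (\<Sum>d\<in>diagrams_from w k n. q ^ sum_list (snd d))"

lemma path_weight_0: "path_weight w q k 0 = (if k = 0 then 1 else 0)"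
  by (simp add: path_weight_def diagrams_from_0)

lemma path_weight_beyond: "w < k \<Longrightarrow> path_weight w q k n = 0"
  by (simp add: path_weight_def diagrams_from_beyond)

lemma sum_cons_diagram:
  "(\<Sum>d\<in>cons_diagram x ` (A \<times> D). q ^ sum_list (snd d)) =
     (\<Sum>a\<in>A. q ^ a) * (\<Sum>d\<in>D. (q::'a::comm_ring_1) ^ sum_list (snd d))"
proof -
  have "(\<Sum>d\<in>cons_diagram x ` (A \<times> D). q ^ sum_list (snd d)) =
          (\<Sum>(a, d)\<in>A \<times> D. q ^ a * q ^ sum_list (snd d))"
    by (subst sum.reindex[OF inj_cons_diagram])
       (auto simp: cons_diagram_def power_add intro!: sum.cong)
  also have "\<dots> = (\<Sum>a\<in>A. q ^ a) * (\<Sum>d\<in>D. q ^ sum_list (snd d))"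
    by (simp add: sum_product sum.cartesian_product)
  finally show ?thesis .
qed

lemma path_weight_Suc:
  assumes "k \<le> w"
  shows "path_weight w q k (Suc n) =
           (\<Sum>i<Suc k. q ^ i) * path_weight w q (Suc k) n +
           (\<Sum>i<k. q ^ i) * path_weight w q (k - 1) n"
proof -
  have "path_weight w q k (Suc n) =
      (\<Sum>d\<in>cons_diagram (StepA k) ` ({..k} \<times> diagrams_from w (Suc k) n). q ^ sum_list (snd d)) +
      (\<Sum>d\<in>cons_diagram (StepB k) ` ({..<k} \<times> diagrams_from w (k - 1) n). q ^ sum_list (snd d))"
    unfolding path_weight_def diagrams_from_Suc[OF assms]
    by (rule sum.union_disjoint) (auto simp: finite_diagrams_from cons_diagram_def)
  then show ?thesis
    by (simp only: sum_cons_diagram path_weight_def lessThan_Suc_atMost)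
qed

text \<open>Each step changes the height by one. This allows odd powers of \<open>t\<close> to be
  inserted into the series over \<open>t ^ (2 * N)\<close>.\<close>

lemma path_weight_parity: "odd (n + k) \<Longrightarrow> path_weight w q k n = 0"
proof (induction n arbitrary: k)
  case 0
  then show ?case by (cases k) (auto simp: path_weight_0)
next
  case (Suc n)
  show ?case
  proof (cases "k \<le> w")
    case True
    then show ?thesis
      using Suc.IH[of "Suc k"] Suc.IH[of "k - 1"] Suc.prems
      \<comment> \<open>For \<open>k = 0\<close> the truncated \<open>k - 1\<close> has the wrong
        parity, but its coefficient is an empty sum.\<close>
      by (cases "k = 0") (auto simp: path_weight_Suc)
  qed (simp add: path_weight_beyond)
qed

lemma norm_path_weight_le:
  fixes q :: "'a::{real_normed_algebra_1, comm_ring_1}"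
  shows "norm (path_weight w q k n) \<le> path_weight w (norm q) k n"
  unfolding path_weight_def by (intro sum_norm_le norm_power_ineq)

lemma path_weight_nonneg: "0 \<le> q \<Longrightarrow> 0 \<le> path_weight w (q::real) k n"
  by (simp add: path_weight_def sum_nonneg)

text \<open>Prepending \<open>k\<close> up steps, all labelled 0, embeds the paths from height
  \<open>k\<close> into those from height 0 without changing their weights. The induction prepends
  one step at a time; label 0 is the summand 1 in the geometric sum.\<close>

lemma path_weight_le_from_0:
  fixes q :: real
  assumes "0 \<le> q"
  shows "path_weight w q k n \<le> path_weight w q 0 (n + k)"
proof (induction k arbitrary: n)
  case (Suc k)
  show ?case
  proof (cases "k \<le> w")
    case True
    have "1 \<le> (\<Sum>i<Suc k. q ^ i)"
      using assms by (simp add: sum.lessThan_Suc_shift sum_nonneg del: sum.lessThan_Suc)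
    then have "path_weight w q (Suc k) n \<le> (\<Sum>i<Suc k. q ^ i) * path_weight w q (Suc k) n"
      using mult_right_mono[OF _ path_weight_nonneg[OF assms], of 1] by simp
    also have "\<dots> \<le> path_weight w q k (Suc n)"
      unfolding path_weight_Suc[OF True]
      by (simp add: assms path_weight_nonneg sum_nonneg del: sum.lessThan_Suc)
    also have "\<dots> \<le> path_weight w q 0 (Suc n + k)"
      by (rule Suc.IH)
    finally show ?thesis by simp
  qed (simp add: path_weight_beyond path_weight_nonneg assms)
qed simp

section \<open>From diagram counts to convergent power series in \<open>t\<close>\<close>

lemma path_diagrams_pos_eq:
  "path_diagrams pos w N m = {d \<in> diagrams_from w 0 (2 * N). sum_list (snd d) = m}"
  by (auto simp: path_diagrams_def diagrams_from_def strip_path_def dyck_path_def)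

text \<open>Grouping the finitely many diagrams by label sum leaves only finitely many nonzero
  terms.\<close>

lemma has_sum_num_diagrams:
  fixes q :: "'a::{real_normed_field}"
  shows "((\<lambda>m. of_nat (num_diagrams w N m) * q ^ m) has_sum path_weight w q 0 (2 * N)) UNIV"
proof -
  let ?D = "diagrams_from w 0 (2 * N)" and ?s = "\<lambda>d. sum_list (snd d)"
  have "path_weight w q 0 (2 * N) = (\<Sum>m\<in>?s ` ?D. \<Sum>d\<in>{d\<in>?D. ?s d = m}. q ^ ?s d)"
    unfolding path_weight_def by (rule sum.image_gen[OF finite_diagrams_from])
  also have "\<dots> = (\<Sum>m\<in>?s ` ?D. of_nat (num_diagrams w N m) * q ^ m)"
    by (intro sum.cong refl) (simp add: num_diagrams_def path_diagrams_pos_eq)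
  finally have *: "path_weight w q 0 (2 * N) =
      (\<Sum>m\<in>?s ` ?D. of_nat (num_diagrams w N m) * q ^ m)" .
  have "((\<lambda>m. of_nat (num_diagrams w N m) * q ^ m) has_sum path_weight w q 0 (2 * N)) (?s ` ?D)"
    unfolding * by (intro has_sum_finite finite_imageI finite_diagrams_from)
  then show ?thesis
  proof (rule has_sum_cong_neutral[THEN iffD1, rotated -1])
    fix m assume "m \<in> UNIV - ?s ` ?D"
    then have "path_diagrams pos w N m = {}"
      by (force simp: path_diagrams_pos_eq)
    then show "of_nat (num_diagrams w N m) * q ^ m = 0"
      by (simp add: num_diagrams_def)
  qed auto
qed

text \<open>Unconditional summability permits summing over \<open>m\<close> first; the missing odd
  powers of \<open>t\<close> have coefficient 0 by parity. The general field allows a second use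
  with \<open>norm t\<close> and \<open>norm q\<close>.\<close>

lemma sums_path_weight:
  fixes t q :: "'a::{real_normed_field, banach}"
  assumes "((\<lambda>(N, m). of_nat (num_diagrams w N m) * t ^ (2 * N) * q ^ m) has_sum S) UNIV"
  shows "(\<lambda>n. t ^ n * path_weight w q 0 n) sums S"
proof -
  have "((\<lambda>N. t ^ (2 * N) * path_weight w q 0 (2 * N)) has_sum S) UNIV"
  proof (rule has_sum_SigmaD)
    show "((\<lambda>(N, m). of_nat (num_diagrams w N m) * t ^ (2 * N) * q ^ m) has_sum S) (UNIV \<times> UNIV)"
      using assms by simp
    show "((\<lambda>m. case (N, m) of (N, m) \<Rightarrow> of_nat (num_diagrams w N m) * t ^ (2 * N) * q ^ m)
        has_sum t ^ (2 * N) * path_weight w q 0 (2 * N)) UNIV" for N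
      using has_sum_cmult_right[OF has_sum_num_diagrams, of "t ^ (2 * N)" w N q]
      by (simp add: mult_ac)
  qed
  then have "(\<lambda>N. t ^ (2 * N) * path_weight w q 0 (2 * N)) sums S"
    by (rule has_sum_imp_sums)
  then show ?thesis
  proof (rule sums_mono_reindex[where f = "\<lambda>n. t ^ n * path_weight w q 0 n", THEN iffD1, rotated -1])
    show "strict_mono (\<lambda>N::nat. 2 * N)" by (simp add: strict_mono_def)
    fix n :: nat assume "n \<notin> range (\<lambda>N. 2 * N)"
    then have "odd n" by (auto elim!: evenE)
    then show "t ^ n * path_weight w q 0 n = 0"
      by (simp add: path_weight_parity)
  qed
qed

text \<open>By the embedding into paths from height 0, the \<open>n\<close>-th term is at most
  \<open>norm t\<close> to the power \<open>-k\<close> times term \<open>n + k\<close> of the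
  convergent series from height 0.\<close>

lemma summable_path_weight_norm:
  fixes t q :: "'a::{real_normed_field, banach}"
  assumes "t \<noteq> 0" and "summable (\<lambda>n. norm t ^ n * path_weight w (norm q) 0 n)"
  shows "summable (\<lambda>n. t ^ n * path_weight w q k n)"
proof (rule summable_comparison_test')
  show "summable (\<lambda>n. inverse (norm t ^ k) * (norm t ^ (n + k) * path_weight w (norm q) 0 (n + k)))"
    using assms by (intro summable_mult) (subst summable_iff_shift, simp)
  fix n :: nat
  have "norm (t ^ n * path_weight w q k n) \<le> norm t ^ n * path_weight w (norm q) 0 (n + k)"
    unfolding norm_mult norm_power
    by (intro mult_left_mono order_trans[OF norm_path_weight_le path_weight_le_from_0]) auto
  also have "\<dots> = inverse (norm t ^ k) * (norm t ^ (n + k) * path_weight w (norm q) 0 (n + k))"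
    using assms(1) by (simp add: power_add field_simps)
  finally show "norm (t ^ n * path_weight w q k n) \<le> \<dots>" .
qed

text \<open>The first-step decomposition is summed over all lengths; the initial 1 is the empty
  path. At \<open>k = 0\<close> the coefficient of \<open>g (k - 1)\<close> is an empty sum.\<close>

lemma suminf_path_weight_rec:
  fixes t q :: "'a::{real_normed_field, banach}"
  assumes summ: "\<And>k. summable (\<lambda>n. t ^ n * path_weight w q k n)" and "k \<le> w"
  defines "g \<equiv> \<lambda>k. \<Sum>n. t ^ n * path_weight w q k n"
  shows "g k = (if k = 0 then 1 else 0) +
           t * (\<Sum>i<Suc k. q ^ i) * g (Suc k) + t * (\<Sum>i<k. q ^ i) * g (k - 1)"
proof -
  have "g k = path_weight w q k 0 + (\<Sum>n. t ^ Suc n * path_weight w q k (Suc n))"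
    unfolding g_def by (subst suminf_split_head[OF summ]) simp
  also have "(\<lambda>n. t ^ Suc n * path_weight w q k (Suc n)) =
     (\<lambda>n. t * (\<Sum>i<Suc k. q ^ i) * (t ^ n * path_weight w q (Suc k) n) +
          t * (\<Sum>i<k. q ^ i) * (t ^ n * path_weight w q (k - 1) n))"
    by (simp add: path_weight_Suc[OF \<open>k \<le> w\<close>] algebra_simps del: sum.lessThan_Suc)
  also have "suminf \<dots> = t * (\<Sum>i<Suc k. q ^ i) * g (Suc k) + t * (\<Sum>i<k. q ^ i) * g (k - 1)"
    unfolding g_def
    by (intro sums_unique[symmetric] sums_add sums_mult summable_sums summ)
  finally show ?thesis
    by (simp add: path_weight_0)
qed

section \<open>The q-difference equation of \<open>psi\<close>\<close>

definition psi_coeff :: "complex \<Rightarrow> complex \<Rightarrow> complex \<Rightarrow> nat \<Rightarrow> complex" where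
  "psi_coeff q r l k =
     qpoch (\<i> * l * r) q k * qpoch (- \<i> * l * r) q k / (qpoch (l\<^sup>2 * q) q k * qpoch q q k)"

lemma psi_eq_suminf: "psi q r l x = (\<Sum>k. psi_coeff q r l k * x ^ k)"
  by (simp add: psi_def psi_coeff_def)

lemma qpoch_Suc: "qpoch a q (Suc n) = qpoch a q n * (1 - a * q ^ n)"
  by (simp add: qpoch_def)

context
  fixes q r l :: complex
  assumes q: "norm q < 1" and r: "r\<^sup>2 = q"
    and nz: "\<And>k. qpoch (l\<^sup>2 * q) q k * qpoch q q k \<noteq> 0"
begin

lemma psi_denominator_nonzero: "1 - l\<^sup>2 * q ^ Suc n \<noteq> 0" "1 - q ^ Suc n \<noteq> 0"
  using nz[of "Suc n"] by (auto simp: qpoch_Suc mult_ac)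

lemma psi_coeff_Suc:
  "(1 - q ^ Suc n) * (1 - l\<^sup>2 * q ^ Suc n) * psi_coeff q r l (Suc n) =
     (1 + l\<^sup>2 * q * (q ^ n)\<^sup>2) * psi_coeff q r l n"
proof -
  \<comment> \<open>The factors have the form (1 - i z)(1 + i z) = 1 + z^2 with z =
    \<open>l * r * q ^ n\<close>, so the square root \<open>r\<close> enters only through
    \<open>r\<^sup>2 = q\<close>.\<close>
  have "(1 - \<i> * l * r * q ^ n) * (1 - - \<i> * l * r * q ^ n) = 1 + l\<^sup>2 * q * (q ^ n)\<^sup>2"
    by (simp add: r[symmetric] algebra_simps power2_eq_square)
  then have "psi_coeff q r l (Suc n) * ((1 - l\<^sup>2 * q * q ^ n) * (1 - q * q ^ n)) =
      (1 + l\<^sup>2 * q * (q ^ n)\<^sup>2) * psi_coeff q r l n"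
    using psi_denominator_nonzero[of n] nz[of n]
    unfolding psi_coeff_def qpoch_Suc by (simp add: divide_simps mult_ac)
  then show ?thesis by (simp add: mult_ac)
qed

text \<open>Ratio test: \<open>?R n\<close> is the quotient of consecutive terms and tends to
  \<open>x\<close>, since the powers of \<open>q\<close> tend to 0.\<close>

lemma summable_psi:
  assumes "norm x < 1"
  shows "summable (\<lambda>n. psi_coeff q r l n * x ^ n)"
proof -
  let ?R = "\<lambda>n. (1 + l\<^sup>2 * q * (q ^ n)\<^sup>2) / ((1 - q ^ Suc n) * (1 - l\<^sup>2 * q ^ Suc n)) * x"
  have "(\<lambda>n. q ^ n) \<longlonglongrightarrow> 0" using q by (rule LIMSEQ_power_zero)
  moreover from this have "(\<lambda>n. q ^ Suc n) \<longlonglongrightarrow> 0" by (rule LIMSEQ_Suc)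
  ultimately have "?R \<longlonglongrightarrow> (1 + l\<^sup>2 * q * 0\<^sup>2) / ((1 - 0) * (1 - l\<^sup>2 * 0)) * x"
    using q by (intro tendsto_intros) auto
  then have "(\<lambda>n. norm (?R n)) \<longlonglongrightarrow> norm x"
    by (auto dest: tendsto_norm)
  moreover obtain c where c: "norm x < c" "c < 1"
    using assms dense by blast
  ultimately have "eventually (\<lambda>n. norm (?R n) < c) sequentially"
    by (auto dest: order_tendstoD)
  then obtain N where N: "\<And>n. n \<ge> N \<Longrightarrow> norm (?R n) < c"
    by (auto simp: eventually_sequentially)
  show ?thesis
  proof (rule summable_ratio_test[OF c(2)])
    fix n assume "n \<ge> N"
    have "psi_coeff q r l (Suc n) = (1 + l\<^sup>2 * q * (q ^ n)\<^sup>2) * psi_coeff q r l n /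
        ((1 - q ^ Suc n) * (1 - l\<^sup>2 * q ^ Suc n))"
      using psi_coeff_Suc[of n] psi_denominator_nonzero[of n]
      by (subst nonzero_eq_divide_eq) (simp_all add: mult_ac)
    then have "psi_coeff q r l (Suc n) * x ^ Suc n = ?R n * (psi_coeff q r l n * x ^ n)"
      by simp
    then show "norm (psi_coeff q r l (Suc n) * x ^ Suc n) \<le> c * norm (psi_coeff q r l n * x ^ n)"
      using N[OF \<open>n \<ge> N\<close>] by (simp only: norm_mult[of "?R n"] mult_right_mono less_imp_le norm_ge_zero)
  qed
qed

text \<open>Replacing \<open>x\<close> by \<open>x * q\<close> multiplies the \<open>n\<close>-th
  coefficient by \<open>q ^ n\<close>. Hence psi(x) - (1 + l^2) psi(xq) + l^2 psi(xq^2) has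
  coefficients containing the factor (1 - q^n)(1 - l^2 q^n), which is exactly what the coefficient
  recurrence turns into a shift of the index.\<close>

lemma psi_q_difference:
  assumes x: "norm x < 1"
  shows "(1 + l\<^sup>2) * psi q r l (x * q) =
           (1 - x * q) * l\<^sup>2 * psi q r l (x * q\<^sup>2) + (1 - x) * psi q r l x"
proof -
  let ?c = "psi_coeff q r l"
  have *: "norm (y * q) < 1" if "norm y < 1" for y
    using mult_strict_mono'[of "norm y" 1 "norm q" 1] that q by (simp add: norm_mult)
  have "norm (x * q) < 1" "norm (x * q\<^sup>2) < 1"
    using *[OF x] *[OF *[OF x]] by (simp_all add: power2_eq_square mult.assoc)
  then have s: "(\<lambda>n. ?c n * x ^ n) sums psi q r l x"
      "(\<lambda>n. ?c n * (x * q) ^ n) sums psi q r l (x * q)"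
      "(\<lambda>n. ?c n * (x * q\<^sup>2) ^ n) sums psi q r l (x * q\<^sup>2)"
    unfolding psi_eq_suminf using x by (auto intro!: summable_sums summable_psi)
  define a where "a n = ?c n * x ^ n * ((1 - q ^ n) * (1 - l\<^sup>2 * q ^ n))" for n
  have "(\<lambda>n. ?c n * x ^ n + l\<^sup>2 * (?c n * (x * q\<^sup>2) ^ n) - (1 + l\<^sup>2) * (?c n * (x * q) ^ n)) sums
          (psi q r l x + l\<^sup>2 * psi q r l (x * q\<^sup>2) - (1 + l\<^sup>2) * psi q r l (x * q))"
    by (intro sums_add sums_diff sums_mult s)
  also have "(\<lambda>n. ?c n * x ^ n + l\<^sup>2 * (?c n * (x * q\<^sup>2) ^ n) - (1 + l\<^sup>2) * (?c n * (x * q) ^ n)) = a"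
    by (auto simp: a_def algebra_simps power_mult_distrib power_mult[symmetric] power2_eq_square
        fun_eq_iff)
  finally have a: "a sums (psi q r l x + l\<^sup>2 * psi q r l (x * q\<^sup>2) - (1 + l\<^sup>2) * psi q r l (x * q))" .
  have "(\<lambda>n. x * (?c n * x ^ n + l\<^sup>2 * q * (?c n * (x * q\<^sup>2) ^ n))) sums
          (x * (psi q r l x + l\<^sup>2 * q * psi q r l (x * q\<^sup>2)))"
    by (intro sums_add sums_mult s)
  also have "(\<lambda>n. x * (?c n * x ^ n + l\<^sup>2 * q * (?c n * (x * q\<^sup>2) ^ n))) = (\<lambda>n. a (Suc n))"
  proof
    fix n
    have "a (Suc n) = x * x ^ n *
        ((1 - q ^ Suc n) * (1 - l\<^sup>2 * q ^ Suc n) * ?c (Suc n))"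
      by (simp add: a_def)
    also have "\<dots> = x * (?c n * x ^ n + l\<^sup>2 * q * (?c n * (x * q\<^sup>2) ^ n))"
      unfolding psi_coeff_Suc
      by (simp add: algebra_simps power_mult_distrib power2_eq_square)
    finally show "x * (?c n * x ^ n + l\<^sup>2 * q * (?c n * (x * q\<^sup>2) ^ n)) = a (Suc n)" by simp
  qed
  \<comment> \<open>Since \<open>a 0 = 0\<close>, the shifted series has the same sum; uniqueness of
    the sum then gives the equation.\<close>
  finally have "a sums (x * (psi q r l x + l\<^sup>2 * q * psi q r l (x * q\<^sup>2)))"
    by (subst (asm) sums_Suc_iff) (simp add: a_def)
  from sums_unique2[OF a this] show ?thesis
    by (simp add: algebra_simps)
qed

text \<open>This is the q-difference equation at \<open>x = q ^ k\<close>, multiplied by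
  \<open>l ^ (k - 1)\<close>. For \<open>k > 0\<close> the point \<open>q ^ k\<close> lies inside
  the unit disc, where the series converges.\<close>

lemma psi_three_term:
  assumes "l \<noteq> 0" and "k > 0"
  defines "u \<equiv> \<lambda>k. l ^ k * psi q r l (q ^ Suc k)"
  shows "(l + 1 / l) * u k = (1 - q ^ Suc k) * u (Suc k) + (1 - q ^ k) * u (k - 1)"
proof -
  obtain j where j: "k = Suc j" using \<open>k > 0\<close> by (cases k) auto
  have "norm (q ^ k) < 1"
    using q \<open>k > 0\<close> by (simp add: norm_power power_less_one_iff)
  from psi_q_difference[OF this]
  have e: "(1 + l\<^sup>2) * psi q r l (q ^ Suc k) =
      (1 - q ^ Suc k) * l\<^sup>2 * psi q r l (q ^ Suc (Suc k)) + (1 - q ^ k) * psi q r l (q ^ k)"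
    by (simp add: power2_eq_square mult_ac)
  have "(l + 1 / l) * u k = l ^ j * ((1 + l\<^sup>2) * psi q r l (q ^ Suc k))"
    using \<open>l \<noteq> 0\<close> by (simp add: u_def j field_simps power2_eq_square)
  also have "\<dots> = (1 - q ^ Suc k) * u (Suc k) + (1 - q ^ k) * u (k - 1)"
    unfolding e by (simp add: u_def j algebra_simps power2_eq_square)
  finally show ?thesis .
qed

end

section \<open>Solving the linear system\<close>

text \<open>Two consecutive zeros at the top propagate downwards, because a nonzero \<open>b\<close>
  lets the recurrence be solved for its lowest term.\<close>

lemma three_term_zero:
  fixes z a b :: "nat \<Rightarrow> 'a::field"
  assumes rec: "\<And>k. 0 < k \<Longrightarrow> k \<le> w \<Longrightarrow> z k = a k * z (Suc k) + b k * z (k - 1)"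
    and b: "\<And>k. 0 < k \<Longrightarrow> b k \<noteq> 0"
    and "z w = 0" "z (Suc w) = 0" and "k \<le> w"
  shows "z k = 0"
proof -
  have "z k = 0 \<and> z (Suc k) = 0"
    using \<open>k \<le> w\<close>
  proof (induction k rule: inc_induct)
    case base
    then show ?case using assms by simp
  next
    case (step k)
    have "z (Suc k) = a (Suc k) * z (Suc (Suc k)) + b (Suc k) * z k"
      using rec[of "Suc k"] step.hyps by auto
    then have "b (Suc k) * z k = 0"
      by (simp add: step.IH)
    then show ?case
      using step.IH b[of "Suc k"] by simp
  qed
  then show ?thesis ..
qed

theorem theorem1p5:
  fixes w :: nat and q r t l lb :: complex
  defines "num \<equiv> l\<^sup>2 * (1 - q) *
             (lb ^ w * psi q r l (q\<^sup>2) * psi q r lb (q ^ (w + 2))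
              - l ^ w * psi q r lb (q\<^sup>2) * psi q r l (q ^ (w + 2)))"
    and "den \<equiv> (1 + l\<^sup>2) *
             (lb ^ w * psi q r l q * psi q r lb (q ^ (w + 2))
              - l ^ (w + 2) * psi q r lb q * psi q r l (q ^ (w + 2)))"
  assumes "norm q < 1"
    and "r\<^sup>2 = q"
    and "t \<noteq> 0"
    and "(\<lambda>p. norm (Gprime_term w t q p)) summable_on UNIV"
    and "l\<^sup>2 - l * (1 - q) / t + 1 = 0"
    and "lb = 1 / l"
    and "\<And>k. qpoch (l\<^sup>2 * q) q k * qpoch q q k \<noteq> 0"
    and "\<And>k. qpoch (lb\<^sup>2 * q) q k * qpoch q q k \<noteq> 0"
    and "den \<noteq> 0"
    and "1 - num / den \<noteq> 0"
  shows "Gprime w t q = 1 / (1 - num / den)"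
proof -
  have l: "l \<noteq> 0" using assms(7) by auto
  have lb: "lb \<noteq> 0" "l * lb = 1" "1 / lb = l" using l \<open>lb = 1 / l\<close> by auto
  have l2: "1 + l\<^sup>2 \<noteq> 0" using \<open>den \<noteq> 0\<close> by (auto simp: den_def)
  have t: "t * (1 + l\<^sup>2) = l * (1 - q)"
    using assms(5,7) by (simp add: field_simps)
  then have t': "t * (l + lb) = 1 - q"
    using l by (simp add: \<open>lb = 1 / l\<close> field_simps power2_eq_square)
  have q1: "q ^ k \<noteq> 1" if "k > 0" for k
    using \<open>norm q < 1\<close> that
    by (metis less_irrefl norm_ge_zero norm_one norm_power power_less_one_iff)
  \<comment> \<open>\<open>B k\<close> is the q-integer [k]; multiplication by \<open>1 - q\<close>
    turns the path recurrence into the one satisfied by \<open>psi\<close>.\<close>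
  define B where "B k = (\<Sum>i<k. q ^ i)" for k
  have B: "B k * (1 - q) = 1 - q ^ k" for k
    by (simp add: B_def one_diff_power_eq mult.commute)
  have B0: "B k \<noteq> 0" if "k > 0" for k
    using B[of k] q1[OF that] by auto

  define g where "g k = (\<Sum>n. t ^ n * path_weight w q k n)" for k
  have gt: "Gprime_term w t q = (\<lambda>(N, m). of_nat (num_diagrams w N m) * t ^ (2 * N) * q ^ m)"
    by (simp add: Gprime_term_def)
  have "Gprime_term w t q summable_on UNIV"
    using assms(6) by (rule abs_summable_summable)
  then have "(Gprime_term w t q has_sum Gprime w t q) UNIV"
    unfolding Gprime_def by (rule has_sum_infsum)
  then have G: "Gprime w t q = g 0"
    unfolding g_def gt by (intro sums_unique sums_path_weight)
  \<comment> \<open>The counts are nonnegative, so the norms are the terms of the same series at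
    \<open>norm t\<close> and \<open>norm q\<close>, and the real instance of
    \<open>sums_path_weight\<close> applies.\<close>
  have "(\<lambda>p. norm (Gprime_term w t q p)) =
      (\<lambda>(N, m). of_nat (num_diagrams w N m) * norm t ^ (2 * N) * norm q ^ m)"
    by (auto simp: Gprime_term_def norm_mult norm_power fun_eq_iff)
  with assms(6) have "(\<lambda>(N, m). of_nat (num_diagrams w N m) * norm t ^ (2 * N) * norm q ^ m)
      summable_on UNIV"
    by simp
  then have "summable (\<lambda>n. norm t ^ n * path_weight w (norm q) 0 n)"
    by (rule sums_summable[OF sums_path_weight[OF has_sum_infsum]])
  then have summ: "summable (\<lambda>n. t ^ n * path_weight w q k n)" for k
    by (rule summable_path_weight_norm[OF \<open>t \<noteq> 0\<close>])
  have g: "g k = (if k = 0 then 1 else 0) + t * B (Suc k) * g (Suc k) + t * B k * g (k - 1)"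
    if "k \<le> w" for k
    using suminf_path_weight_rec[OF summ that] by (simp only: g_def B_def)
  have g_end: "g (Suc w) = 0"
    by (simp add: g_def path_weight_beyond)

  define u where "u k = l ^ k * psi q r l (q ^ Suc k)" for k
  define v where "v k = lb ^ k * psi q r lb (q ^ Suc k)" for k
  \<comment> \<open>The constants \<open>v (Suc w)\<close> and \<open>u (Suc w)\<close> are chosen
    to make \<open>y\<close> vanish just above the strip, as \<open>g\<close> does.\<close>
  define y where "y k = u k * v (Suc w) - v k * u (Suc w)" for k
  have u: "u k = t * B (Suc k) * u (Suc k) + t * B k * u (k - 1)" if "k > 0" for k
  proof -
    have "(1 - q) * u k = t * ((l + lb) * u k)"
      by (simp add: t'[symmetric])
    also have "(l + lb) * u k = (1 - q ^ Suc k) * u (Suc k) + (1 - q ^ k) * u (k - 1)"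
      unfolding u_def \<open>lb = 1 / l\<close> using psi_three_term[OF assms(3,4,9) l that] by simp
    finally have "(1 - q) * u k = (1 - q) * (t * B (Suc k) * u (Suc k) + t * B k * u (k - 1))"
      by (simp only: B[symmetric]) (simp add: algebra_simps)
    then show ?thesis using q1[of 1] by simp
  qed
  have v: "v k = t * B (Suc k) * v (Suc k) + t * B k * v (k - 1)" if "k > 0" for k
  proof -
    have "(1 - q) * v k = t * ((lb + l) * v k)"
      by (simp add: t'[symmetric] add.commute)
    also have "(lb + l) * v k = (1 - q ^ Suc k) * v (Suc k) + (1 - q ^ k) * v (k - 1)"
      unfolding v_def using psi_three_term[OF assms(3,4,10) lb(1) that] by (simp add: lb)
    finally have "(1 - q) * v k = (1 - q) * (t * B (Suc k) * v (Suc k) + t * B k * v (k - 1))"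
      by (simp only: B[symmetric]) (simp add: algebra_simps)
    then show ?thesis using q1[of 1] by simp
  qed
  have y: "y k = t * B (Suc k) * y (Suc k) + t * B k * y (k - 1)" if "k > 0" for k
    unfolding y_def by (subst u[OF that], subst v[OF that]) (simp add: algebra_simps)
  have y_end: "y (Suc w) = 0" by (simp add: y_def)

  \<comment> \<open>The extra factor \<open>l\<close> cancels one \<open>lb\<close> of
    \<open>lb ^ Suc w\<close> and raises \<open>l ^ Suc w\<close> to
    \<open>l ^ (w + 2)\<close>.\<close>
  have den_y: "den = (1 + l\<^sup>2) * l * y 0"
    using lb(2) by (simp add: den_def y_def u_def v_def) (simp add: algebra_simps power2_eq_square)
  have num_y: "num = l\<^sup>2 * (1 - q) * y 1"
  proof -
    have "y 1 = (l * lb) * (lb ^ w * psi q r l (q\<^sup>2) * psi q r lb (q ^ (w + 2))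
              - l ^ w * psi q r lb (q\<^sup>2) * psi q r l (q ^ (w + 2)))"
      by (simp add: y_def u_def v_def algebra_simps power2_eq_square)
    then show ?thesis
      by (simp add: lb(2) num_def)
  qed
  have y0: "y 0 \<noteq> 0" using \<open>den \<noteq> 0\<close> den_y by auto
  \<comment> \<open>The quadratic equation, in the form
    \<open>t * (1 + l\<^sup>2) = l * (1 - q)\<close>, trades the prefactor of \<open>num\<close> for
    that of \<open>den\<close> times \<open>t\<close>.\<close>
  have quot: "num / den = t * y 1 / y 0"
  proof -
    have "num = l * (l * (1 - q)) * y 1"
      by (simp add: num_y power2_eq_square)
    also have "\<dots> = ((1 + l\<^sup>2) * l) * (t * y 1)"
      by (simp add: t[symmetric])
    finally show ?thesis
      using l l2 by (simp add: den_y)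
  qed

  \<comment> \<open>Otherwise \<open>y\<close> would vanish at both \<open>w\<close> and
    \<open>Suc w\<close>, hence at 0, and \<open>den\<close> would be 0.\<close>
  have "y w \<noteq> 0"
  proof
    assume "y w = 0"
    have "y 0 = 0"
      by (rule three_term_zero[where a = "\<lambda>k. t * B (Suc k)" and b = "\<lambda>k. t * B k" and w = w])
         (rule y, assumption, simp_all add: B0 \<open>t \<noteq> 0\<close> \<open>y w = 0\<close> y_end)
    with y0 show False ..
  qed
  \<comment> \<open>The combination \<open>g k * y w - y k * g w\<close> obeys the common recurrence
    and vanishes at \<open>w\<close> and at \<open>Suc w\<close>, hence throughout the
    strip.\<close>
  have gy: "g k * y w = y k * g w" if "k \<le> w" for k
  proof -
    have "g k * y w - y k * g w = 0"
    proof (rule three_term_zero[where z = "\<lambda>k. g k * y w - y k * g w" and a = "\<lambda>k. t * B (Suc k)"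
          and b = "\<lambda>k. t * B k" and w = w])
      fix k :: nat assume k: "0 < k" "k \<le> w"
      show "g k * y w - y k * g w = t * B (Suc k) * (g (Suc k) * y w - y (Suc k) * g w) +
          t * B k * (g (k - 1) * y w - y (k - 1) * g w)"
        using k by (subst g[OF k(2)], subst y[OF k(1)]) (simp add: algebra_simps)
    qed (use B0 \<open>t \<noteq> 0\<close> that g_end y_end in auto)
    then show ?thesis by simp
  qed
  define c where "c = g w / y w"
  \<comment> \<open>The range includes \<open>Suc w\<close>, so that \<open>k = 1\<close> is covered
    even when \<open>w = 0\<close>.\<close>
  have gc: "g k = c * y k" if "k \<le> Suc w" for k
    using gy[of k] that \<open>y w \<noteq> 0\<close> g_end y_end
    by (cases "k = Suc w") (auto simp: c_def field_simps)
  \<comment> \<open>The inhomogeneous equation at the bottom, with [1] = 1 and [0] = 0, fixes the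
    factor \<open>c\<close>.\<close>
  have "g 0 = 1 + t * g 1"
    using g[of 0] by (simp add: B_def)
  then have "c * y 0 - c * (t * y 1) = 1"
    by (simp add: gc)
  moreover have "g 0 * (1 - t * y 1 / y 0) = c * y 0 - c * (t * y 1)"
    using y0 by (simp add: gc algebra_simps)
  ultimately have "g 0 = 1 / (1 - t * y 1 / y 0)"
    by (metis eq_divide_eq mult_zero_right zero_neq_one)
  then show ?thesis
    by (simp add: G quot)
qed

end
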